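(* Let $B$ be a real Banach space with dual $B^*$, and let $C\subset B$ be nonempty, closed, and convex. Then, for any $\phi\in B^*$, the set $\pi_C(\phi)$ is closed, convex, and bounded, provided that $\pi_C(\phi)\neq\emptyset$.
   Context: $\langle\cdot,\cdot\rangle$ is the pairing between $B^*$ and $B$. $V(\phi,x)=\|\phi\|^2-2\langle\phi,x\rangle+\|x\|^2$ for $\phi\in B^*$, $x\in B$. The generalized projection is $\pi_C(\phi)=\{u\in C: V(\phi,u)=\inf_{y\in C}V(\phi,y)\}$ for $\phi\in B^*$ (possibly empty). *)

theory Defs
  imports "HOL-Analysis.Analysis"
begin

text \<open>The dual of a real Banach space is the type of bounded linear functionals
  \<^typ>\<open>('a::banach, real) blinfun\<close>, whose norm is the operator (dual) norm; the pairing
  of \<open>\<phi>\<close> and \<open>x\<close> is \<^term>\<open>blinfun_apply \<phi> x\<close>.\<close>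

definition lyapunov_V :: "('a::banach, real) blinfun \<Rightarrow> 'a \<Rightarrow> real"
  where "lyapunov_V \<phi> x = (norm \<phi>)\<^sup>2 - 2 * blinfun_apply \<phi> x + (norm x)\<^sup>2"

text \<open>The infimum is the one of the reals. It is the true infimum for every nonempty \<open>C\<close>, since
  \<open>V \<phi> x \<ge> (norm \<phi> - norm x)\<^sup>2 \<ge> 0\<close>.\<close>

definition gen_proj :: "'a::banach set \<Rightarrow> ('a, real) blinfun \<Rightarrow> 'a set"
  where "gen_proj C \<phi> = {u \<in> C. lyapunov_V \<phi> u = (INF y\<in>C. lyapunov_V \<phi> y)}"

end

theory Submission
  imports Defs
begin

text \<open>\<open>V \<phi>\<close> is continuous and convex, and \<open>V \<phi> x \<ge> (norm \<phi> - norm x)\<^sup>2\<close> makes it bounded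
  below and coercive. The generalized projection is the intersection of \<open>C\<close> with the sublevel set
  of \<open>V \<phi>\<close> at the infimum, so it inherits closedness, convexity and boundedness.\<close>

text \<open>The right side exceeds the left by
  \<open>2 * (norm \<phi> * norm x - blinfun_apply \<phi> x)\<close>, which the operator norm
  inequality makes nonnegative.\<close>

lemma lyapunov_V_lower: "(norm \<phi> - norm x)\<^sup>2 \<le> lyapunov_V \<phi> x"
proof -
  have "blinfun_apply \<phi> x \<le> norm \<phi> * norm x"
    using norm_blinfun[of \<phi> x] by (simp add: abs_le_iff)
  then show ?thesis
    by (simp add: lyapunov_V_def power2_diff)
qed

lemma lyapunov_V_nonneg: "0 \<le> lyapunov_V \<phi> x"
  using lyapunov_V_lower[of \<phi> x] zero_le_power2[of "norm \<phi> - norm x"] by linarith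

lemma continuous_on_lyapunov_V: "continuous_on S (lyapunov_V \<phi>)"
  unfolding lyapunov_V_def by (intro continuous_intros)

text \<open>Apart from the squared norm, \<open>lyapunov_V \<phi>\<close> is affine, so only
  convexity of the squared norm is at stake.\<close>

lemma convex_on_lyapunov_V: "convex_on UNIV (lyapunov_V \<phi>)"
proof (rule convex_onI)
  fix t :: real and x y :: 'a
  assume t: "0 < t" "t < 1"
  have "(norm ((1 - t) *\<^sub>R x + t *\<^sub>R y))\<^sup>2 \<le> ((1 - t) * norm x + t * norm y)\<^sup>2"
    using t norm_triangle_ineq[of "(1 - t) *\<^sub>R x" "t *\<^sub>R y"] by (intro power_mono) auto
  also have "\<dots> = (1 - t) * (norm x)\<^sup>2 + t * (norm y)\<^sup>2 - t * (1 - t) * (norm x - norm y)\<^sup>2"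
    by (simp add: power2_eq_square algebra_simps)
  also have "\<dots> \<le> (1 - t) * (norm x)\<^sup>2 + t * (norm y)\<^sup>2"
    using t by simp
  finally show "lyapunov_V \<phi> ((1 - t) *\<^sub>R x + t *\<^sub>R y)
      \<le> (1 - t) * lyapunov_V \<phi> x + t * lyapunov_V \<phi> y"
    by (simp add: lyapunov_V_def blinfun.bilinear_simps algebra_simps)
qed simp

text \<open>On \<open>C\<close> the value never lies below the infimum, so equality with it amounts
  to \<le>. An infimum of reals is a lower bound only for sets bounded below, hence the appeal to
  nonnegativity.\<close>

lemma gen_proj_eq_sublevel:
  "gen_proj C \<phi> = C \<inter> {x. lyapunov_V \<phi> x \<le> (INF y\<in>C. lyapunov_V \<phi> y)}"
proof -
  have "bdd_below (lyapunov_V \<phi> ` C)"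
    by (rule bdd_belowI2[where m = 0]) (rule lyapunov_V_nonneg)
  then have "(INF y\<in>C. lyapunov_V \<phi> y) \<le> lyapunov_V \<phi> u" if "u \<in> C" for u
    using that by (rule cINF_lower)
  then show ?thesis
    by (auto simp: gen_proj_def intro: antisym)
qed

lemma closed_lyapunov_V_sublevel: "closed {x. lyapunov_V \<phi> x \<le> m}"
  by (intro closed_Collect_le continuous_on_lyapunov_V continuous_on_const)

lemma convex_lyapunov_V_sublevel: "convex {x. lyapunov_V \<phi> x \<le> m}"
proof (rule convexI)
  fix x y :: 'a and u v :: real
  assume xy: "x \<in> {x. lyapunov_V \<phi> x \<le> m}" "y \<in> {x. lyapunov_V \<phi> x \<le> m}"
    and uv: "0 \<le> u" "0 \<le> v" "u + v = 1"
  have "lyapunov_V \<phi> (u *\<^sub>R x + v *\<^sub>R y) \<le> u * lyapunov_V \<phi> x + v * lyapunov_V \<phi> y"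
    using convex_on_lyapunov_V[of \<phi>] uv by (auto simp: convex_on_def)
  also have "\<dots> \<le> m"
    using xy uv by (intro convex_bound_le) auto
  finally show "u *\<^sub>R x + v *\<^sub>R y \<in> {x. lyapunov_V \<phi> x \<le> m}"
    by simp
qed

lemma bounded_lyapunov_V_sublevel: "bounded {x. lyapunov_V \<phi> x \<le> m}"
proof (rule boundedI)
  fix x
  assume "x \<in> {x. lyapunov_V \<phi> x \<le> m}"
  then have "(norm \<phi> - norm x)\<^sup>2 \<le> m"
    using lyapunov_V_lower[of \<phi> x] by simp
  \<comment> \<open>No sign condition on \<open>m\<close> is called for: a point of the sublevel set
    forces \<open>m\<close> to dominate a square, and for negative \<open>m\<close> the set is
    empty.\<close>
  then have "\<bar>norm \<phi> - norm x\<bar> \<le> sqrt m"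
    using real_le_rsqrt by fastforce
  then show "norm x \<le> norm \<phi> + sqrt m"
    by linarith
qed

theorem proposition2p7:
  fixes C :: "'a::banach set" and \<phi> :: "('a, real) blinfun"
  assumes "C \<noteq> {}" and "closed C" and "convex C"
    and "gen_proj C \<phi> \<noteq> {}"
  shows "closed (gen_proj C \<phi>) \<and> convex (gen_proj C \<phi>) \<and> bounded (gen_proj C \<phi>)"
  unfolding gen_proj_eq_sublevel
  using assms(2,3)
  by (simp add: closed_Int convex_Int bounded_Int
      closed_lyapunov_V_sublevel convex_lyapunov_V_sublevel bounded_lyapunov_V_sublevel)

end
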